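(* Fix a Bayesian network structure $g$ on $N$ discrete variables $x_1,\dots,x_N$, where $x_i$ has $r_i$ states and its parent set has $q_i$ instances. Let $\alpha>0$, $\alpha_{ijk}=\frac{\alpha}{r_iq_i}$, $\alpha_{ij}=\sum_{k=1}^{r_i}\alpha_{ijk}$, and let $n_{ijk}$, $n_{ij}=\sum_{k=1}^{r_i}n_{ijk}$ be the counts obtained from a data set $\mathbf{X}$ of $n$ samples. When $n+\alpha$ is sufficiently large, $$\sum_{i=1}^{N}\sum_{j=1}^{q_i}\left(\sum_{k=1}^{r_i}\log\Gamma(\alpha_{ijk}+n_{ijk})-\log\Gamma(\alpha_{ij}+n_{ij})\right)=\log p(\widehat{\Theta}\mid\mathbf{X},g,\alpha)-\frac12\sum_{i=1}^{N}\sum_{j=1}^{q_i}\left(\frac{r_i-1}{r_i}\sum_{k=1}^{r_i}\log\left(\frac{\alpha_{ijk}+n_{ijk}}{2\pi}\right)\right)+\mathcal{O}(1),$$ where $$\log p(\widehat{\Theta}\mid\mathbf{X},g,\alpha)=\sum_{i=1}^{N}\sum_{j=1}^{q_i}\sum_{k=1}^{r_i}(\alpha_{ijk}+n_{ijk})\log\frac{\alpha_{ijk}+n_{ijk}}{\alpha_{ij}+n_{ij}}$$ and $\mathcal{O}(1)$ denotes a remainder that stays bounded as $n+\alpha\to\infty$ with the structure $g$ fixed.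
   Context: A Bayesian network structure $g$ is a directed acyclic graph on the discrete variables $x_1,\dots,x_N$; $x_i$ takes values in $\{1,\dots,r_i\}$, $\Pi_i$ is the set of parents of $x_i$ in $g$, and $q_i=\prod_{x_l\in\Pi_i}r_l$ is the number of joint states of $\Pi_i$ (with $q_i=1$ if $\Pi_i=\emptyset$), indexed by $j=1,\dots,q_i$. The data set $\mathbf{X}$ consists of $n$ complete observations of $(x_1,\dots,x_N)$; $n_{ijk}$ is the number of samples with $x_i=k$ and $\Pi_i=j$, so $\sum_{j,k}n_{ijk}=n$ for each $i$. $\Gamma$ is the Gamma function. The real number $\alpha>0$ is the equivalent sample size. The left-hand side is the "likelihood term" (the part reflecting the data) of the logarithm of the BDeu marginal likelihood score.
   Formalization: Added: for some c>0, eventually α_ijk+n_ijk ≥ c and (α_ijk+n_ijk)/(α_ij+n_ij) ≥ c for all i with r_i ≥ 2 and all j,k. Without it the claim fails: N=1, r_1=2, α=1, all n samples equal gives remainder (1/4) log n + O(1). *)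

theory Defs
  imports "HOL-Analysis.Analysis" "HOL-Library.Landau_Symbols"
begin

record bayes_net =
  num_vars :: nat
  num_states :: "nat \<Rightarrow> nat"
  edges :: "nat rel"

definition bn_structure :: "bayes_net \<Rightarrow> bool" where
  "bn_structure g \<longleftrightarrow>
     edges g \<subseteq> {1..num_vars g} \<times> {1..num_vars g} \<and> acyclic (edges g) \<and>
     (\<forall>i\<in>{1..num_vars g}. 1 \<le> num_states g i)"

definition parents :: "bayes_net \<Rightarrow> nat \<Rightarrow> nat set" where
  "parents g i = {l. (l, i) \<in> edges g}"

definition num_parent_states :: "bayes_net \<Rightarrow> nat \<Rightarrow> nat" where
  "num_parent_states g i = (\<Prod>l\<in>parents g i. num_states g l)"

text \<open>A joint state of the parents of variable \<open>i\<close> is itself used as the index \<open>j\<close>, instead of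
  its position in some enumeration of all joint states by \<open>1, \<dots>, q\<^sub>i\<close>; see
  \<open>card_parent_states\<close>. Without parents, the only joint state is the empty assignment.\<close>

definition parent_states :: "bayes_net \<Rightarrow> nat \<Rightarrow> (nat \<Rightarrow> nat) set" where
  "parent_states g i = (\<Pi>\<^sub>E l\<in>parents g i. {1..num_states g l})"

lemma finite_parents: "bn_structure g \<Longrightarrow> finite (parents g i)"
  by (rule finite_subset[of _ "{1..num_vars g}"]) (auto simp: bn_structure_def parents_def)

lemma card_parent_states:
  "bn_structure g \<Longrightarrow> card (parent_states g i) = num_parent_states g i"
  by (simp add: parent_states_def num_parent_states_def card_PiE finite_parents)

definition data_set :: "bayes_net \<Rightarrow> (nat \<Rightarrow> nat) list \<Rightarrow> bool" where
  "data_set g X \<longleftrightarrow> set X \<subseteq> (\<Pi>\<^sub>E i\<in>{1..num_vars g}. {1..num_states g i})"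

definition count_ijk ::
    "bayes_net \<Rightarrow> (nat \<Rightarrow> nat) list \<Rightarrow> nat \<Rightarrow> (nat \<Rightarrow> nat) \<Rightarrow> nat \<Rightarrow> nat" where
  "count_ijk g X i j k = length (filter (\<lambda>x. x i = k \<and> restrict x (parents g i) = j) X)"

definition count_ij :: "bayes_net \<Rightarrow> (nat \<Rightarrow> nat) list \<Rightarrow> nat \<Rightarrow> (nat \<Rightarrow> nat) \<Rightarrow> nat" where
  "count_ij g X i j = (\<Sum>k=1..num_states g i. count_ijk g X i j k)"

definition alpha_ijk :: "bayes_net \<Rightarrow> real \<Rightarrow> nat \<Rightarrow> (nat \<Rightarrow> nat) \<Rightarrow> nat \<Rightarrow> real" where
  "alpha_ijk g \<alpha> i j k = \<alpha> / (real (num_states g i) * real (num_parent_states g i))"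

definition alpha_ij :: "bayes_net \<Rightarrow> real \<Rightarrow> nat \<Rightarrow> (nat \<Rightarrow> nat) \<Rightarrow> real" where
  "alpha_ij g \<alpha> i j = (\<Sum>k=1..num_states g i. alpha_ijk g \<alpha> i j k)"

definition log_posterior :: "bayes_net \<Rightarrow> real \<Rightarrow> (nat \<Rightarrow> nat) list \<Rightarrow> real" where
  "log_posterior g \<alpha> X =
     (\<Sum>i=1..num_vars g. \<Sum>j\<in>parent_states g i. \<Sum>k=1..num_states g i.
        (alpha_ijk g \<alpha> i j k + real (count_ijk g X i j k)) *
        ln ((alpha_ijk g \<alpha> i j k + real (count_ijk g X i j k)) /
            (alpha_ij g \<alpha> i j + real (count_ij g X i j))))"

end

theory Submission
  imports Defs
begin

text \<open>By Stirling's formula, \<open>ln (Gamma x) = (x - 1/2) ln x - x + O(1)\<close> on \<open>[c, \<infinity>)\<close>. Applied to all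
  Gamma values of a block \<open>(i, j)\<close> with \<open>r \<ge> 2\<close> states, with entries \<open>a k\<close> of sum \<open>S\<close>, the difference
  of both sides collapses to \<open>- (\<Sum>k. ln (a k / S)) / (2 r) + O(1)\<close>, and every ratio \<open>a k / S\<close> lies in
  \<open>[c, 1]\<close>. Blocks with a single state contribute exactly zero.

  For the boundedness, the error \<open>R x\<close> in Stirling's formula decreases and \<open>R x - 1 / (4 x)\<close> increases
  under \<open>x \<mapsto> x + 1\<close>, so both are controlled by the values of \<open>R\<close> on the compact interval
  \<open>[c, c + 1]\<close>.\<close>

text \<open>The constant \<open>ln (2 * pi) / 2\<close>, the limit at infinity by Stirling's
  formula, is left inside: only boundedness matters.\<close>

definition stirling_rem :: "real \<Rightarrow> real" where
  "stirling_rem x = ln (Gamma x) - (x - 1 / 2) * ln x + x"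

text \<open>The functional equation of Gamma eliminates Gamma from the increment, so elementary
  bounds on \<open>ln (x + 1) - ln x\<close> suffice.\<close>

lemma stirling_rem_Suc:
  assumes "0 < x"
  shows "stirling_rem (x + 1) = stirling_rem x + 1 - (x + 1 / 2) * (ln (x + 1) - ln x)"
proof -
  have "ln (Gamma (x + 1)) = ln x + ln (Gamma x)"
    using assms Gamma_plus1[of x] by (auto simp: ln_mult_pos nonpos_Ints_def)
  then show ?thesis by (simp add: stirling_rem_def algebra_simps)
qed

text \<open>Midpoint rule: as \<open>1 / t\<close> is convex, its integral over
  \<open>{x..x + 1}\<close> is at least its value at \<open>x + 1 / 2\<close>.\<close>

lemma stirling_rem_Suc_le:
  assumes "0 < x"
  shows "stirling_rem (x + 1) \<le> stirling_rem x"
proof -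
  have "(x + 1 / 2) * (2 / (2 * x + 1)) \<le> (x + 1 / 2) * (ln (x + 1) - ln x)"
    using assms ln_inverse_approx_ge[of x "x + 1"] by (intro mult_left_mono) (auto simp: add_ac)
  also have "(x + 1 / 2) * (2 / (2 * x + 1)) = 1"
    using assms by (simp add: field_simps)
  finally show ?thesis using stirling_rem_Suc[OF assms] by simp
qed

text \<open>Trapezoidal rule: convexity of \<open>1 / t\<close> now bounds the integral from above,
  and the excess \<open>1 / (4 * x * (x + 1))\<close> telescopes.\<close>

lemma stirling_rem_Suc_ge:
  assumes "0 < x"
  shows "stirling_rem x - 1 / (4 * x) \<le> stirling_rem (x + 1) - 1 / (4 * (x + 1))"
proof -
  have "(x + 1 / 2) * (ln (x + 1) - ln x) \<le> (x + 1 / 2) * ((1 / x + 1 / (x + 1)) / 2)"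
    using assms ln_inverse_approx_le[of x 1]
    by (intro mult_left_mono) (auto simp: inverse_eq_divide)
  also have "\<dots> = 1 + (1 / (4 * x) - 1 / (4 * (x + 1)))"
    using assms by (simp add: divide_simps) (simp add: algebra_simps)
  finally show ?thesis using stirling_rem_Suc[OF assms] by simp
qed

lemma continuous_on_stirling_rem: "continuous_on {0<..} stirling_rem"
proof -
  have "continuous_on {0<..} (Gamma :: real \<Rightarrow> real)"
    by (rule continuous_on_Gamma) (auto simp: nonpos_Ints_def)
  moreover have "Gamma x \<noteq> 0" if "0 < x" for x :: real
    using Gamma_real_pos[OF that] by linarith
  ultimately show ?thesis
    unfolding stirling_rem_def by (intro continuous_intros) auto
qed

lemma stirling_rem_bounded:
  fixes c :: real
  assumes "0 < c"
  obtains B where "\<And>x. c \<le> x \<Longrightarrow> \<bar>stirling_rem x\<bar> \<le> B"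
proof -
  have "compact (stirling_rem ` {c..c + 1})"
    using assms
    by (intro compact_continuous_image continuous_on_subset[OF continuous_on_stirling_rem]) auto
  then obtain B where B: "\<And>y. y \<in> {c..c + 1} \<Longrightarrow> \<bar>stirling_rem y\<bar> \<le> B"
    by (force dest!: compact_imp_bounded simp: bounded_iff)
  have shift: "stirling_rem (y + real m) \<le> stirling_rem y \<and>
      stirling_rem y - 1 / (4 * y) \<le> stirling_rem (y + real m) - 1 / (4 * (y + real m))"
    if "0 < y" for y m
  proof (induction m)
    case (Suc m)
    then show ?case
      using that stirling_rem_Suc_le[of "y + real m"] stirling_rem_Suc_ge[of "y + real m"]
      by (simp add: add_ac)
  qed simp
  \<comment> \<open>Unit steps carry \<open>x\<close> down to some \<open>y\<close> in
    \<open>{c..c + 1}\<close>. From \<open>y\<close> back up to \<open>x\<close> the remainder does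
    not grow, and it drops by less than \<open>1 / (4 * y)\<close>, hence by less than
    \<open>1 / (4 * c)\<close>.\<close>
  have "\<bar>stirling_rem x\<bar> \<le> B + 1 / (4 * c)" if "c \<le> x" for x
  proof -
    define m where "m = nat \<lfloor>x - c\<rfloor>"
    define y where "y = x - real m"
    have m: "real m = of_int \<lfloor>x - c\<rfloor>"
      using that by (simp add: m_def)
    have y: "y \<in> {c..c + 1}"
      unfolding y_def m by (auto; linarith)
    have x: "x = y + real m"
      by (simp add: y_def)
    have "1 / (4 * y) \<le> 1 / (4 * c)"
      using assms y by (intro divide_left_mono) auto
    moreover have "0 < 1 / (4 * (y + real m))"
      using assms y by (intro divide_pos_pos) auto
    moreover have "0 < 1 / (4 * c)"
      using assms by simp
    ultimately show ?thesis
      using B[OF y] conjunct1[OF shift, of y m] conjunct2[OF shift, of y m] assms y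
      unfolding x atLeastAtMost_iff by linarith
  qed
  then show thesis by (rule that)
qed

text \<open>The linear Stirling terms cancel because \<open>S\<close> is the sum of the
  \<open>a k\<close>. Of the half-logarithms, the factor \<open>(n - 1) / n\<close> leaves the share
  \<open>1 / (2 * n)\<close> of each \<open>ln (a k)\<close>, and \<open>ln S / 2\<close> splits
  into \<open>n\<close> equal shares to complete the ratios.\<close>

lemma block_identity:
  fixes a :: "'k \<Rightarrow> real"
  assumes "finite A" "A \<noteq> {}" "\<And>k. k \<in> A \<Longrightarrow> 0 < a k"
  defines "S \<equiv> sum a A" and "n \<equiv> real (card A)"
  shows "(\<Sum>k\<in>A. ln (Gamma (a k))) - ln (Gamma S) -
      ((\<Sum>k\<in>A. a k * ln (a k / S)) - 1 / 2 * ((n - 1) / n * (\<Sum>k\<in>A. ln (a k / (2 * pi))))) =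
    (\<Sum>k\<in>A. stirling_rem (a k)) - stirling_rem S
      - 1 / (2 * n) * (\<Sum>k\<in>A. ln (a k / S)) - (n - 1) / 2 * ln (2 * pi)"
proof -
  have S: "0 < S"
    unfolding S_def using assms by (intro sum_pos)
  have n: "n \<noteq> 0"
    using assms by (simp add: n_def)
  have ln_ratio: "ln (a k / S) = ln (a k) - ln S" if "k \<in> A" for k
    using assms(3)[OF that] S by (simp add: ln_div)
  have *: "(\<Sum>k\<in>A. ln (a k / S)) = (\<Sum>k\<in>A. ln (a k)) - n * ln S"
    by (simp add: ln_ratio sum_subtractf n_def)
  have "ln (a k / (2 * pi)) = ln (a k) - ln (2 * pi)" if "k \<in> A" for k
    using assms(3)[OF that] by (subst ln_div) auto
  then have **: "(\<Sum>k\<in>A. ln (a k / (2 * pi))) = (\<Sum>k\<in>A. ln (a k)) - n * ln (2 * pi)"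
    by (simp add: sum_subtractf n_def)
  have "(\<Sum>k\<in>A. a k * ln (a k / S)) = (\<Sum>k\<in>A. a k * ln (a k) - a k * ln S)"
    by (simp add: ln_ratio right_diff_distrib)
  also have "\<dots> = (\<Sum>k\<in>A. a k * ln (a k)) - S * ln S"
    by (simp add: sum_subtractf sum_distrib_right S_def)
  finally have "(\<Sum>k\<in>A. a k * ln (a k / S)) = (\<Sum>k\<in>A. a k * ln (a k)) - S * ln S" .
  moreover have "(\<Sum>k\<in>A. stirling_rem (a k)) =
      (\<Sum>k\<in>A. ln (Gamma (a k))) - (\<Sum>k\<in>A. a k * ln (a k)) + 1 / 2 * (\<Sum>k\<in>A. ln (a k)) + S"
    by (simp add: stirling_rem_def left_diff_distrib sum.distrib sum_subtractf sum_distrib_left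
        S_def)
  moreover have "stirling_rem S = ln (Gamma S) - S * ln S + 1 / 2 * ln S + S"
    by (simp add: stirling_rem_def left_diff_distrib)
  \<comment> \<open>The terms in \<open>q\<close> cancel on the right; \<open>q\<close> becomes
    \<open>ln S\<close>, which makes the sum of log-ratios appear.\<close>
  moreover have "1 / 2 * ((n - 1) / n * (L - n * p)) =
      1 / 2 * L - 1 / (2 * n) * (L - n * q) - 1 / 2 * q - (n - 1) / 2 * p" for L p q
    using n by (simp add: field_simps)
  from this[of "\<Sum>k\<in>A. ln (a k)" "ln (2 * pi)" "ln S"]
  have "1 / 2 * ((n - 1) / n * (\<Sum>k\<in>A. ln (a k / (2 * pi)))) = 1 / 2 * (\<Sum>k\<in>A. ln (a k))
      - 1 / (2 * n) * (\<Sum>k\<in>A. ln (a k / S)) - 1 / 2 * ln S - (n - 1) / 2 * ln (2 * pi)"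
    unfolding * ** .
  ultimately show ?thesis by linarith
qed

text \<open>The bound \<open>B\<close> is fixed before \<open>a\<close>, so that one constant serves
  all parameters \<open>t\<close> at once.\<close>

lemma block_bounded:
  fixes A :: "'k set" and c :: real
  assumes "finite A" "A \<noteq> {}" "0 < c"
  obtains B where "\<And>a. (\<And>k. k \<in> A \<Longrightarrow> c \<le> a k \<and> c \<le> a k / sum a A) \<Longrightarrow>
    \<bar>(\<Sum>k\<in>A. ln (Gamma (a k))) - ln (Gamma (sum a A)) -
      ((\<Sum>k\<in>A. a k * ln (a k / sum a A)) - 1 / 2 * ((real (card A) - 1) / real (card A) *
        (\<Sum>k\<in>A. ln (a k / (2 * pi)))))\<bar> \<le> B"
proof -
  define n where "n = real (card A)"
  obtain C where C: "\<And>x. c \<le> x \<Longrightarrow> \<bar>stirling_rem x\<bar> \<le> C"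
    using stirling_rem_bounded[OF \<open>0 < c\<close>] by blast
  show thesis
  proof (rule that)
    fix a
    assume a: "\<And>k. k \<in> A \<Longrightarrow> c \<le> a k \<and> c \<le> a k / sum a A"
    define S where "S = sum a A"
    have le_S: "a k \<le> S" if "k \<in> A" for k
      unfolding S_def using assms a that by (intro member_le_sum) fastforce+
    obtain k0 where "k0 \<in> A" using assms by blast
    \<comment> \<open>This makes the Stirling bound \<open>C\<close> applicable to the Gamma term of
      the sum as well.\<close>
    then have S: "c \<le> S" using a le_S by force
    have "\<bar>\<Sum>k\<in>A. stirling_rem (a k)\<bar> \<le> n * C"
      unfolding n_def using a C by (intro order_trans[OF sum_abs sum_bounded_above]) auto
    moreover have "\<bar>1 / (2 * n) * (\<Sum>k\<in>A. ln (a k / S))\<bar> \<le> \<bar>1 / (2 * n)\<bar> * (n * \<bar>ln c\<bar>)"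
    proof -
      have "\<bar>ln (a k / S)\<bar> \<le> \<bar>ln c\<bar>" if "k \<in> A" for k
      proof -
        have "c \<le> a k / S" "a k / S \<le> 1"
          using a[OF that] le_S[OF that] S assms by (auto simp: S_def)
        then have "ln c \<le> ln (a k / S)" "ln (a k / S) \<le> 0"
          using assms by auto
        then show ?thesis by simp
      qed
      then have "\<bar>\<Sum>k\<in>A. ln (a k / S)\<bar> \<le> n * \<bar>ln c\<bar>"
        unfolding n_def by (intro order_trans[OF sum_abs sum_bounded_above]) auto
      then show ?thesis unfolding abs_mult by (intro mult_left_mono) auto
    qed
    moreover have "0 < a k" if "k \<in> A" for k using a[OF that] assms by simp
    note block_identity[of A a, OF assms(1,2) this]
    ultimately show "\<bar>(\<Sum>k\<in>A. ln (Gamma (a k))) - ln (Gamma (sum a A)) -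
        ((\<Sum>k\<in>A. a k * ln (a k / sum a A)) - 1 / 2 * ((real (card A) - 1) / real (card A) *
          (\<Sum>k\<in>A. ln (a k / (2 * pi)))))\<bar>
        \<le> n * C + C + \<bar>1 / (2 * n)\<bar> * (n * \<bar>ln c\<bar>) + \<bar>(n - 1) / 2 * ln (2 * pi)\<bar>"
      using C[OF S] unfolding n_def S_def by linarith
  qed
qed

text \<open>Prior weight and data vary together along \<open>F\<close>. The constant
  \<open>c\<close> keeps the ratios away from 0: for entries bounded below, the remainder is, up to
  O(1), a sum of nonnegative terms \<open>- ln (a k / S) / (2 * r)\<close>, which is unbounded if
  some ratio with \<open>r\<close> \<ge> 2 tends to 0.\<close>

theorem theorem4:
  fixes g :: bayes_net
    and \<alpha> :: "'t \<Rightarrow> real"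
    and X :: "'t \<Rightarrow> (nat \<Rightarrow> nat) list"
    and F :: "'t filter"
    and c :: real
  assumes "bn_structure g"
    and "\<And>t. 0 < \<alpha> t"
    and "\<And>t. data_set g (X t)"
    and "filterlim (\<lambda>t. real (length (X t)) + \<alpha> t) at_top F"
    and "0 < c"
    and "\<forall>\<^sub>F t in F. \<forall>i\<in>{1..num_vars g}. 2 \<le> num_states g i \<longrightarrow>
           (\<forall>j\<in>parent_states g i. \<forall>k\<in>{1..num_states g i}.
              c \<le> alpha_ijk g (\<alpha> t) i j k + real (count_ijk g (X t) i j k) \<and>
              c \<le> (alpha_ijk g (\<alpha> t) i j k + real (count_ijk g (X t) i j k)) /
                   (alpha_ij g (\<alpha> t) i j + real (count_ij g (X t) i j)))"
  shows "(\<lambda>t.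
      (\<Sum>i=1..num_vars g. \<Sum>j\<in>parent_states g i.
         (\<Sum>k=1..num_states g i.
            ln (Gamma (alpha_ijk g (\<alpha> t) i j k + real (count_ijk g (X t) i j k))))
         - ln (Gamma (alpha_ij g (\<alpha> t) i j + real (count_ij g (X t) i j))))
      - (log_posterior g (\<alpha> t) (X t)
         - 1 / 2 * (\<Sum>i=1..num_vars g. \<Sum>j\<in>parent_states g i.
             (real (num_states g i) - 1) / real (num_states g i) *
             (\<Sum>k=1..num_states g i.
                ln ((alpha_ijk g (\<alpha> t) i j k + real (count_ijk g (X t) i j k)) / (2 * pi))))))
    \<in> O[F](\<lambda>_. 1)"
proof -
  define a where "a = (\<lambda>t i j k. alpha_ijk g (\<alpha> t) i j k + real (count_ijk g (X t) i j k))"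
  have a_eq: "alpha_ijk g (\<alpha> t) i j k + real (count_ijk g (X t) i j k) = a t i j k" for t i j k
    by (simp add: a_def)
  have sum_a: "alpha_ij g (\<alpha> t) i j + real (count_ij g (X t) i j) = sum (a t i j) {1..num_states g i}"
    for t i j
    by (simp add: a_def alpha_ij_def count_ij_def sum.distrib)
  define D where "D = (\<lambda>i j t.
      (\<Sum>k=1..num_states g i. ln (Gamma (a t i j k)))
      - ln (Gamma (sum (a t i j) {1..num_states g i}))
      - ((\<Sum>k=1..num_states g i. a t i j k * ln (a t i j k / sum (a t i j) {1..num_states g i}))
         - 1 / 2 * ((real (num_states g i) - 1) / real (num_states g i) *
             (\<Sum>k=1..num_states g i. ln (a t i j k / (2 * pi))))))"
  have D_bounded: "D i j \<in> O[F](\<lambda>_. 1)"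
    if i: "i \<in> {1..num_vars g}" and j: "j \<in> parent_states g i" for i j
  proof (cases "2 \<le> num_states g i")
    case True
    obtain B where B: "\<And>b. (\<And>k. k \<in> {1..num_states g i} \<Longrightarrow>
          c \<le> b k \<and> c \<le> b k / sum b {1..num_states g i}) \<Longrightarrow>
        \<bar>(\<Sum>k=1..num_states g i. ln (Gamma (b k))) - ln (Gamma (sum b {1..num_states g i})) -
          ((\<Sum>k=1..num_states g i. b k * ln (b k / sum b {1..num_states g i})) -
            1 / 2 * ((real (card {1..num_states g i}) - 1) / real (card {1..num_states g i}) *
              (\<Sum>k=1..num_states g i. ln (b k / (2 * pi)))))\<bar> \<le> B"
      using block_bounded[of "{1..num_states g i}" c] True \<open>0 < c\<close> by auto
    have "\<forall>\<^sub>F t in F. \<forall>k\<in>{1..num_states g i}.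
        c \<le> a t i j k \<and> c \<le> a t i j k / sum (a t i j) {1..num_states g i}"
      using assms(6) by eventually_elim (use i j True in \<open>simp add: sum_a a_eq\<close>)
    then have "\<forall>\<^sub>F t in F. \<bar>D i j t\<bar> \<le> B"
    proof eventually_elim
      case (elim t)
      then show ?case using B[of "a t i j"] by (simp add: D_def)
    qed
    then show ?thesis by (intro bigoI[where c = B]) simp
  next
    case False
    moreover have "1 \<le> num_states g i"
      using assms(1) i by (simp add: bn_structure_def)
    ultimately have "num_states g i = 1" by simp
    \<comment> \<open>With one state, the entry equals the sum: the Gamma terms cancel, the entry
      times the logarithm of its ratio is 0, and so is the factor
      \<open>(r - 1) / r\<close>.\<close>
    then have "D i j = (\<lambda>_. 0)"
      by (simp add: D_def fun_eq_iff)
    then show ?thesis by simp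
  qed
  \<comment> \<open>The index sets depend on \<open>g\<close> alone, so the blocks summed are the
    same for every \<open>t\<close>.\<close>
  have "(\<lambda>t. \<Sum>i=1..num_vars g. \<Sum>j\<in>parent_states g i. D i j t) \<in> O[F](\<lambda>_. 1)"
    by (intro big_sum_in_bigo D_bounded)
  then show ?thesis
    unfolding D_def log_posterior_def sum_a a_eq
    by (simp only: sum_subtractf sum_distrib_left)
qed

end
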